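(* For $t\in\{e,p\}$ and every integer $v\ge1$, there is a polynomial $P^t_v\in\mathbb Q[d]$ of degree exactly $\lfloor\log_2 v\rfloor$ such that $n^t_v(d)=P^t_v(d)$ for all integers $d\ge0$. That is, the number of $(d+1)$-espaliers of volume $v$ and the number of $(d+1)$-pyramids of volume $v$ are both polynomials in $d$ of degree $\lfloor\log_2 v\rfloor$.
   Context: Let $d\ge1$. A $(d+1)$-pyramid of height $h\ge1$ is a finite set of unit cells of $\mathbb Z^{d+1}$ (a cell identified with its smallest vertex) of the form $\bigcup_{a=0}^{h-1}\{a\}\times B_a$, where each $B_a=\prod_{k=1}^d\{b_{a,k},\dots,b_{a,k}+\ell_{a,k}-1\}\subset\mathbb Z^d$ is a nonempty box of cells ($\ell_{a,k}\ge1$), $b_{0,k}=0$ for all $k$, and $B_a\subseteq B_{a-1}$ for $1\le a\le h-1$. A $(d+1)$-espalier is a $(d+1)$-pyramid with $b_{a,k}=0$ for all $a,k$ (each plateau contains the cell $(a,0,\dots,0)$). The volume is the total number of cells. For $t=e$ (espaliers) or $t=p$ (pyramids), $n^t_v(d)$ is the number of $(d+1)$-espaliers, resp. $(d+1)$-pyramids, of volume $v$ (of any height). By convention $n^t_v(0)=1$ for all $v\ge1$. *)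

theory Defs
  imports Complex_Main "HOL-Computational_Algebra.Polynomial"
begin

text \<open>
  A cell of \<open>\<int>\<^sup>n\<close> is an \<^typ>\<open>int list\<close> of length \<open>n\<close>. Coordinates are numbered from \<open>0\<close>, so the
  index \<open>k \<in> {1..d}\<close> of the usual notation becomes \<open>k < d\<close>; values of \<open>b\<close> and \<open>l\<close> at
  \<open>k \<ge> d\<close> are irrelevant.
\<close>

definition cell_box :: "nat \<Rightarrow> (nat \<Rightarrow> int) \<Rightarrow> (nat \<Rightarrow> nat) \<Rightarrow> int list set" where
  "cell_box d b l = {x. length x = d \<and> (\<forall>k<d. x ! k \<in> {b k .. b k + int (l k) - 1})}"

text \<open>Cell \<open>(a, x)\<close> of \<open>\<int>\<^bsup>d+1\<^esup>\<close> is \<open>int a # x\<close>: the height is the head of the list.\<close>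

definition stack_cells ::
    "nat \<Rightarrow> nat \<Rightarrow> (nat \<Rightarrow> nat \<Rightarrow> int) \<Rightarrow> (nat \<Rightarrow> nat \<Rightarrow> nat) \<Rightarrow> int list set" where
  "stack_cells d h b l = (\<Union>a<h. (\<lambda>x. int a # x) ` cell_box d (b a) (l a))"

definition pyramid_data ::
    "nat \<Rightarrow> nat \<Rightarrow> (nat \<Rightarrow> nat \<Rightarrow> int) \<Rightarrow> (nat \<Rightarrow> nat \<Rightarrow> nat) \<Rightarrow> bool" where
  "pyramid_data d h b l \<longleftrightarrow>
     h \<ge> 1 \<and>
     (\<forall>a<h. \<forall>k<d. l a k \<ge> 1) \<and>
     (\<forall>k<d. b 0 k = 0) \<and>
     (\<forall>a. 1 \<le> a \<and> a < h \<longrightarrow> cell_box d (b a) (l a) \<subseteq> cell_box d (b (a - 1)) (l (a - 1)))"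

text \<open>\<open>pyramid d\<close> and \<open>espalier d\<close> are the \<open>(d+1)\<close>-pyramids and \<open>(d+1)\<close>-espaliers, of any height.\<close>

definition pyramid :: "nat \<Rightarrow> int list set \<Rightarrow> bool" where
  "pyramid d S \<longleftrightarrow> (\<exists>h b l. pyramid_data d h b l \<and> S = stack_cells d h b l)"

definition espalier :: "nat \<Rightarrow> int list set \<Rightarrow> bool" where
  "espalier d S \<longleftrightarrow>
     (\<exists>h b l. pyramid_data d h b l \<and> (\<forall>a<h. \<forall>k<d. b a k = 0) \<and> S = stack_cells d h b l)"

text \<open>
  For \<open>d = 0\<close> the value \<open>1\<close> is a convention. It agrees with the count: the only \<open>1\<close>-pyramid of
  volume \<open>v \<ge> 1\<close> is the column \<open>{[0], \<dots>, [v - 1]}\<close>.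
\<close>

definition num_espaliers :: "nat \<Rightarrow> nat \<Rightarrow> nat" where
  "num_espaliers v d = (if d = 0 then 1 else card {S. espalier d S \<and> card S = v})"

definition num_pyramids :: "nat \<Rightarrow> nat \<Rightarrow> nat" where
  "num_pyramids v d = (if d = 0 then 1 else card {S. pyramid d S \<and> card S = v})"

end

theory Submission
  imports Defs "HOL-Library.FuncSet"
begin

text \<open>
  A pyramid of height \<open>h\<close> in dimension \<open>d + 1\<close> is the same as a family of \<open>d\<close> columns, one for each
  horizontal direction, where a column is a decreasing sequence of \<open>h\<close> nonempty integer intervals.
  A direction whose column is constantly \<open>{0}\<close> does not contribute to the volume. Every other
  direction at least doubles the bottom layer, so in volume \<open>v\<close> there are at most
  \<open>M = \<lfloor>log\<^sub>2 v\<rfloor>\<close> of them. If \<open>F m\<close> counts the families of \<open>m\<close> nontrivial columns of volume \<open>v\<close>,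
  choosing the nontrivial directions gives the count \<open>\<Sum>m\<le>M. (d choose m) * F m\<close>, and
  \<open>F M > 0\<close>: put a column of \<open>v - 2\<^sup>M\<close> cells on a cube of \<open>2\<^sup>M\<close> cells.
\<close>

section \<open>Boxes, columns and stacks\<close>

definition product_cells :: "nat \<Rightarrow> (nat \<Rightarrow> int set) \<Rightarrow> int list set" where
  "product_cells d I = {x. length x = d \<and> (\<forall>k<d. x ! k \<in> I k)}"

definition layered_cells :: "nat \<Rightarrow> nat \<Rightarrow> (nat \<Rightarrow> nat \<Rightarrow> int set) \<Rightarrow> int list set" where
  "layered_cells d h f = (\<Union>a<h. (\<lambda>x. int a # x) ` product_cells d (\<lambda>k. f k a))"

text \<open>The flag \<open>e\<close> selects the columns of espaliers; layers from \<open>h\<close> on are empty.\<close>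

definition columns :: "bool \<Rightarrow> nat \<Rightarrow> (nat \<Rightarrow> int set) set" where
  "columns e h = {c. (\<forall>a<h. \<exists>b. \<exists>l\<ge>1. c a = {b..b + int l - 1}) \<and> (\<forall>a\<ge>h. c a = {}) \<and>
     Min (c 0) = 0 \<and> (\<forall>a. c (Suc a) \<subseteq> c a) \<and> (e \<longrightarrow> (\<forall>a<h. Min (c a) = 0))}"

definition unit_column :: "nat \<Rightarrow> nat \<Rightarrow> int set" where
  "unit_column h a = (if a < h then {0} else {})"

text \<open>The height is kept as a separate component because \<open>f\<close> carries no
  information when \<open>A\<close> is empty. An arbitrary set \<open>A\<close> of directions is
  allowed, so that a stack can later be restricted to its nontrivial directions.\<close>

definition stacks :: "bool \<Rightarrow> nat \<Rightarrow> nat set \<Rightarrow> (nat \<times> (nat \<Rightarrow> nat \<Rightarrow> int set)) set" where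
  "stacks e v A = {(h, f). h \<ge> 1 \<and> f \<in> A \<rightarrow>\<^sub>E columns e h \<and> (\<Sum>a<h. \<Prod>k\<in>A. card (f k a)) = v}"

definition full_stacks :: "bool \<Rightarrow> nat \<Rightarrow> nat set \<Rightarrow> (nat \<times> (nat \<Rightarrow> nat \<Rightarrow> int set)) set" where
  "full_stacks e v A = {(h, f) \<in> stacks e v A. \<forall>k\<in>A. f k \<noteq> unit_column h}"

section \<open>Intervals and columns\<close>

lemma atLeastAtMost_Min_card:
  fixes I :: "int set"
  assumes "I = {b..b + int l - 1}" "l \<ge> 1"
  shows "Min I = b" "card I = l" "finite I"
proof -
  show "finite I" using assms by simp
  show "card I = l" using assms by simp
  show "Min I = b" using assms by (intro Min_eqI) auto
qed

lemma columnsD: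
  assumes "c \<in> columns e h" "a < h"
  shows "c a = {Min (c a)..Min (c a) + int (card (c a)) - 1}" "card (c a) \<ge> 1" "c a \<noteq> {}"
    "finite (c a)"
proof -
  obtain b l where bl: "c a = {b..b + int l - 1}" "l \<ge> 1"
    using assms unfolding columns_def by blast
  note bl' = atLeastAtMost_Min_card[OF bl]
  show "c a = {Min (c a)..Min (c a) + int (card (c a)) - 1}" unfolding bl' by (fact bl(1))
  show "card (c a) \<ge> 1" "finite (c a)" using bl' bl by auto
  then show "c a \<noteq> {}" by auto
qed

lemma columns_subset_0:
  assumes "c \<in> columns e h"
  shows "c a \<subseteq> c 0"
  using lift_Suc_antimono_le[of c 0 a] assms unfolding columns_def by simp

lemma columns_ge: "c \<in> columns e h \<Longrightarrow> h \<le> a \<Longrightarrow> c a = {}"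
  unfolding columns_def by blast

lemma unit_column_in_columns:
  assumes "h \<ge> 1"
  shows "unit_column h \<in> columns e h"
proof -
  have "unit_column h a = {0..0 + int 1 - 1}" if "a < h" for a
    using that unfolding unit_column_def by simp
  then have "\<forall>a<h. \<exists>b. \<exists>l\<ge>1. unit_column h a = {b..b + int l - 1}" by (meson order_refl)
  then show ?thesis using assms unfolding columns_def unit_column_def by simp
qed

text \<open>A bottom interval with one point must be {0} by the normalisation
  \<open>Min (c 0) = 0\<close>. The later intervals are nonempty subsets of it, so the whole column
  would be trivial.\<close>

lemma card_0_ge_2:
  assumes "c \<in> columns e h" "h \<ge> 1" "c \<noteq> unit_column h"
  shows "card (c 0) \<ge> 2"
proof (rule ccontr)
  assume "\<not> card (c 0) \<ge> 2"
  then have "card (c 0) = 1" using columnsD(2)[OF assms(1), of 0] assms(2) by linarith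
  moreover have "Min (c 0) = 0" using assms(1) unfolding columns_def by simp
  ultimately have "c 0 = {0}" using columnsD(1)[OF assms(1), of 0] assms(2) by simp
  then have "c a = unit_column h a" for a
    using columns_subset_0[OF assms(1), of a] columnsD(3)[OF assms(1), of a]
      columns_ge[OF assms(1), of a]
    unfolding unit_column_def by (cases "a < h") auto
  then show False using assms(3) by auto
qed

section \<open>Sides and cardinality of boxes\<close>

lemma product_cells_witness:
  assumes "\<And>k. k < d \<Longrightarrow> I k \<noteq> {}" "k < d" "y \<in> I k"
  obtains x where "x \<in> product_cells d I" "x ! k = y"
proof -
  let ?x = "map (\<lambda>i. if i = k then y else SOME z. z \<in> I i) [0..<d]"
  have "?x \<in> product_cells d I" using assms
    unfolding product_cells_def by (auto simp: some_in_eq)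
  moreover have "?x ! k = y" using assms by simp
  ultimately show ?thesis using that by blast
qed

lemma product_cells_nonempty:
  assumes "\<And>k. k < d \<Longrightarrow> I k \<noteq> {}"
  shows "product_cells d I \<noteq> {}"
proof -
  have "map (\<lambda>i. SOME z. z \<in> I i) [0..<d] \<in> product_cells d I" using assms
    unfolding product_cells_def by (auto simp: some_in_eq)
  then show ?thesis by blast
qed

text \<open>A nonempty box determines its sides as its projections. This gives both the injectivity
  of \<open>layered_cells\<close> and the passage from nested boxes to nested intervals.\<close>

lemma product_cells_nth_image:
  assumes "\<And>k. k < d \<Longrightarrow> I k \<noteq> {}" "k < d"
  shows "(\<lambda>x. x ! k) ` product_cells d I = I k"
proof
  show "(\<lambda>x. x ! k) ` product_cells d I \<subseteq> I k"
    using assms(2) unfolding product_cells_def by auto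
  show "I k \<subseteq> (\<lambda>x. x ! k) ` product_cells d I"
  proof
    fix y assume "y \<in> I k"
    then obtain x where "x \<in> product_cells d I" "x ! k = y"
      using product_cells_witness[of d I k y] assms by blast
    then show "y \<in> (\<lambda>x. x ! k) ` product_cells d I" by blast
  qed
qed

lemma bij_betw_product_cells:
  "bij_betw (\<lambda>g. map g [0..<d]) (PiE {..<d} I) (product_cells d I)"
proof (rule bij_betw_byWitness[where f' = "\<lambda>x. restrict (\<lambda>k. x ! k) {..<d}"])
  show "\<forall>a\<in>PiE {..<d} I. restrict (\<lambda>k. map a [0..<d] ! k) {..<d} = a"
    by (auto simp: PiE_iff extensional_def restrict_def fun_eq_iff)
  show "\<forall>a'\<in>product_cells d I. map (restrict (\<lambda>k. a' ! k) {..<d}) [0..<d] = a'"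
    unfolding product_cells_def by (auto intro!: nth_equalityI)
  show "(\<lambda>g. map g [0..<d]) ` PiE {..<d} I \<subseteq> product_cells d I"
    unfolding product_cells_def by (simp add: image_subset_iff PiE_iff)
  show "(\<lambda>x. restrict (\<lambda>k. x ! k) {..<d}) ` product_cells d I \<subseteq> PiE {..<d} I"
    unfolding product_cells_def by (simp add: image_subset_iff)
qed

lemma card_product_cells: "card (product_cells d I) = (\<Prod>k<d. card (I k))"
  using bij_betw_same_card[OF bij_betw_product_cells, of d I] by (simp add: card_PiE)

lemma finite_product_cells: "(\<And>k. k < d \<Longrightarrow> finite (I k)) \<Longrightarrow> finite (product_cells d I)"
  using bij_betw_finite[OF bij_betw_product_cells, of d I] by (metis finite_PiE finite_lessThan lessThan_iff)

lemma card_layered_cells: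
  assumes "\<And>a k. a < h \<Longrightarrow> k < d \<Longrightarrow> finite (f k a)"
  shows "card (layered_cells d h f) = (\<Sum>a<h. \<Prod>k<d. card (f k a))"
proof -
  have "card (layered_cells d h f)
      = (\<Sum>a<h. card ((\<lambda>x. int a # x) ` product_cells d (\<lambda>k. f k a)))"
    unfolding layered_cells_def
    by (rule card_UN_disjoint) (auto intro!: finite_imageI finite_product_cells assms)
  also have "\<dots> = (\<Sum>a<h. \<Prod>k<d. card (f k a))"
    by (intro sum.cong refl) (simp add: card_image inj_on_def card_product_cells)
  finally show ?thesis .
qed

section \<open>Recovering a stack from its cells\<close>

lemma layer_eq: "{x. int a # x \<in> layered_cells d h f} = (if a < h then product_cells d (\<lambda>k. f k a) else {})"
  unfolding layered_cells_def by auto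

lemma inj_on_layered_cells: "inj_on (\<lambda>(h, f). layered_cells d h f) (stacks e v {..<d})"
proof (rule inj_onI, clarify)
  fix h f h' f'
  assume hf: "(h, f) \<in> stacks e v {..<d}" and hf': "(h', f') \<in> stacks e v {..<d}"
    and eq: "layered_cells d h f = layered_cells d h' f'"
  have f: "f \<in> {..<d} \<rightarrow>\<^sub>E columns e h" and f': "f' \<in> {..<d} \<rightarrow>\<^sub>E columns e h'"
    using hf hf' unfolding stacks_def by auto
  have ne: "f k a \<noteq> {}" if "k < d" "a < h" for k a
    using f that columnsD(3)[of "f k" e h a] by auto
  have ne': "f' k a \<noteq> {}" if "k < d" "a < h'" for k a
    using f' that columnsD(3)[of "f' k" e h' a] by auto
  have layer: "(if a < h then product_cells d (\<lambda>k. f k a) else {})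
      = (if a < h' then product_cells d (\<lambda>k. f' k a) else {})" for a
    using layer_eq[of a d h f] layer_eq[of a d h' f'] eq by simp
  \<comment> \<open>The height is recovered as the number of nonempty layers. This works even for
    \<open>d = 0\<close>, where the box is the singleton of the empty list.\<close>
  have "a < h \<longleftrightarrow> a < h'" for a
    using layer[of a] product_cells_nonempty[of d "\<lambda>k. f k a"]
      product_cells_nonempty[of d "\<lambda>k. f' k a"] ne ne' by (auto split: if_splits)
  then have h: "h = h'" by (meson nat_neq_iff)
  have "f k = f' k" if k: "k < d" for k
  proof
    fix a
    show "f k a = f' k a"
    proof (cases "a < h")
      case True
      then have "product_cells d (\<lambda>k. f k a) = product_cells d (\<lambda>k. f' k a)"
        using layer[of a] h by simp
      then show ?thesis
        using product_cells_nth_image[of d "\<lambda>k. f k a" k]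
          product_cells_nth_image[of d "\<lambda>k. f' k a" k] ne ne' k True h by auto
    next
      case False
      have "f k \<in> columns e h" "f' k \<in> columns e h" using f f' k h by auto
      then show ?thesis using False columns_ge[of _ e h a] by auto
    qed
  qed
  then have "f = f'" using PiE_ext[OF f] f' h by blast
  then show "h = h' \<and> f = f'" using h by simp
qed

section \<open>Pyramids as families of columns\<close>

lemma cell_box_eq: "cell_box d b l = product_cells d (\<lambda>k. {b k..b k + int (l k) - 1})"
  unfolding cell_box_def product_cells_def ..

lemma product_cells_mono: "(\<And>k. k < d \<Longrightarrow> I k \<subseteq> J k) \<Longrightarrow> product_cells d I \<subseteq> product_cells d J"
  unfolding product_cells_def by blast

lemma product_cells_cong: "(\<And>k. k < d \<Longrightarrow> I k = J k) \<Longrightarrow> product_cells d I = product_cells d J"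
  using product_cells_mono by (simp add: subset_antisym)

lemma ex_pyramid_data_iff:
  "(\<exists>h b l. pyramid_data d h b l \<and> (e \<longrightarrow> (\<forall>a<h. \<forall>k<d. b a k = 0)) \<and> S = stack_cells d h b l)
   \<longleftrightarrow> (\<exists>h\<ge>1. \<exists>f \<in> {..<d} \<rightarrow>\<^sub>E columns e h. S = layered_cells d h f)" (is "?L \<longleftrightarrow> ?R")
proof
  assume ?L
  then obtain h b l where p: "pyramid_data d h b l"
    and e: "e \<Longrightarrow> \<forall>a<h. \<forall>k<d. b a k = 0" and S: "S = stack_cells d h b l" by blast
  define I where "I a k = {b a k..b a k + int (l a k) - 1}" for a k
  \<comment> \<open>Empty layers from \<open>h\<close> on and the restriction to
    \<open>{..<d}\<close> give the unique representative that \<open>columns\<close> and the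
    extensional function space require.\<close>
  define f where "f = (\<lambda>k\<in>{..<d}. \<lambda>a. if a < h then I a k else {})"
  have h: "h \<ge> 1" and l: "\<And>a k. a < h \<Longrightarrow> k < d \<Longrightarrow> l a k \<ge> 1"
    and b0: "\<And>k. k < d \<Longrightarrow> b 0 k = 0"
    and sub: "\<And>a. Suc a < h \<Longrightarrow> product_cells d (I (Suc a)) \<subseteq> product_cells d (I a)"
    using p unfolding pyramid_data_def cell_box_eq I_def by force+
  have Min: "Min (I a k) = b a k" and ne: "I a k \<noteq> {}" if "a < h" "k < d" for a k
    using atLeastAtMost_Min_card(1)[OF I_def l[OF that]] l[OF that] unfolding I_def by auto
  \<comment> \<open>Inclusion of boxes implies inclusion of sides because the boxes are
    nonempty.\<close>
  have "I (Suc a) k \<subseteq> I a k" if "Suc a < h" "k < d" for a k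
    using product_cells_nth_image[of d "I (Suc a)" k] product_cells_nth_image[of d "I a" k]
      image_mono[OF sub[OF that(1)], of "\<lambda>x. x ! k"] ne that by auto
  moreover have "\<exists>b. \<exists>l\<ge>1. I a k = {b..b + int l - 1}" if "a < h" "k < d" for a k
    using l[OF that] unfolding I_def by blast
  ultimately have "f \<in> {..<d} \<rightarrow>\<^sub>E columns e h"
    using Min b0 e h unfolding f_def columns_def by auto
  moreover have "S = layered_cells d h f"
    unfolding S stack_cells_def layered_cells_def cell_box_eq f_def I_def
    by (intro SUP_cong refl arg_cong2[where f = image] product_cells_cong) auto
  ultimately show ?R using h by blast
next
  assume ?R
  then obtain h f where h: "h \<ge> 1" and f: "f \<in> {..<d} \<rightarrow>\<^sub>E columns e h"
    and S: "S = layered_cells d h f" by blast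
  \<comment> \<open>Corners and side lengths need not be stored in a column: they are the minimum
    and the cardinality of each interval.\<close>
  define b where "b a k = Min (f k a)" for a k
  define l where "l a k = card (f k a)" for a k
  have fk: "f k \<in> columns e h" if "k < d" for k using f that by auto
  have I: "f k a = {b a k..b a k + int (l a k) - 1}" if "a < h" "k < d" for a k
    unfolding b_def l_def using columnsD(1)[OF fk] that by blast
  have cb: "cell_box d (b a) (l a) = product_cells d (\<lambda>k. f k a)" if "a < h" for a
    unfolding cell_box_eq using I that by (intro product_cells_cong) auto
  have "cell_box d (b a) (l a) \<subseteq> cell_box d (b (a - 1)) (l (a - 1))" if a: "1 \<le> a" "a < h" for a
  proof -
    have "f k a \<subseteq> f k (a - 1)" if "k < d" for k
      using fk[OF that] a unfolding columns_def by (cases a) auto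
    then show ?thesis using cb[of a] cb[of "a - 1"] a by (auto intro!: product_cells_mono)
  qed
  moreover have "l a k \<ge> 1" if "a < h" "k < d" for a k
    unfolding l_def using columnsD(2)[OF fk] that by blast
  moreover have "b 0 k = 0" "e \<Longrightarrow> a < h \<Longrightarrow> b a k = 0" if "k < d" for a k
    using fk[OF that] unfolding b_def columns_def by auto
  ultimately have "pyramid_data d h b l" "e \<longrightarrow> (\<forall>a<h. \<forall>k<d. b a k = 0)"
    using h unfolding pyramid_data_def by auto
  moreover have "S = stack_cells d h b l"
    unfolding S stack_cells_def layered_cells_def using cb by auto
  ultimately show ?L by blast
qed

lemma card_pyramids_eq:
  "card {S. (\<exists>h b l. pyramid_data d h b l \<and> (e \<longrightarrow> (\<forall>a<h. \<forall>k<d. b a k = 0)) \<and>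
     S = stack_cells d h b l) \<and> card S = v} = card (stacks e v {..<d})"
proof -
  have vol: "card (layered_cells d h f) = (\<Sum>a<h. \<Prod>k<d. card (f k a))"
    if "f \<in> {..<d} \<rightarrow>\<^sub>E columns e h" for h f
    using that by (intro card_layered_cells) (auto intro: columnsD(4))
  have "{S. (\<exists>h\<ge>1. \<exists>f \<in> {..<d} \<rightarrow>\<^sub>E columns e h. S = layered_cells d h f) \<and> card S = v}
      = (\<lambda>(h, f). layered_cells d h f) ` stacks e v {..<d}" (is "?L = ?R")
  proof
    show "?L \<subseteq> ?R"
    proof clarify
      fix h f assume "h \<ge> 1" "f \<in> {..<d} \<rightarrow>\<^sub>E columns e h" "v = card (layered_cells d h f)"
      then have "(h, f) \<in> stacks e (card (layered_cells d h f)) {..<d}"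
        unfolding stacks_def using vol by simp
      then show "layered_cells d h f
          \<in> (\<lambda>(h, f). layered_cells d h f) ` stacks e (card (layered_cells d h f)) {..<d}"
        by force
    qed
    show "?R \<subseteq> ?L"
    proof clarify
      fix h f assume "(h, f) \<in> stacks e v {..<d}"
      then show "(\<exists>h'\<ge>1. \<exists>f' \<in> {..<d} \<rightarrow>\<^sub>E columns e h'.
          layered_cells d h f = layered_cells d h' f') \<and> card (layered_cells d h f) = v"
        unfolding stacks_def using vol by blast
    qed
  qed
  then show ?thesis unfolding ex_pyramid_data_iff
    by (simp add: card_image[OF inj_on_layered_cells])
qed

section \<open>Finiteness\<close>

text \<open>Every layer has at least one cell, so \<open>h\<close> is at most \<open>v\<close>. A
  bottom interval starts at 0 and has at most \<open>v\<close> points, which confines its whole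
  column to {0..v}.\<close>

lemma finite_stacks:
  assumes "finite A"
  shows "finite (stacks e v A)"
proof -
  define D where "D h = {c :: nat \<Rightarrow> int set.
    \<forall>a. (a \<in> {..<h} \<longrightarrow> c a \<in> Pow {0..int v}) \<and> (a \<notin> {..<h} \<longrightarrow> c a = {})}" for h
  have "finite (D h)" for h
    unfolding D_def by (rule finite_set_of_finite_funs) auto
  then have "finite (SIGMA h:{..v}. A \<rightarrow>\<^sub>E D h)"
    using assms by (intro finite_SigmaI finite_PiE) auto
  moreover have "stacks e v A \<subseteq> (SIGMA h:{..v}. A \<rightarrow>\<^sub>E D h)"
  proof clarify
    fix h f assume "(h, f) \<in> stacks e v A"
    then have h: "h \<ge> 1" and f: "f \<in> A \<rightarrow>\<^sub>E columns e h"
      and v: "(\<Sum>a<h. \<Prod>k\<in>A. card (f k a)) = v"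
      unfolding stacks_def by auto
    have fk: "f k \<in> columns e h" if "k \<in> A" for k using f that by auto
    have pos: "card (f k a) \<ge> 1" if "k \<in> A" "a < h" for k a
      using columnsD(2)[OF fk] that by blast
    have "(\<Sum>a<h. 1) \<le> (\<Sum>a<h. \<Prod>k\<in>A. card (f k a))"
      using pos by (intro sum_mono prod_ge_1) auto
    then have "h \<le> v" using v by simp
    moreover have "f k \<in> D h" if k: "k \<in> A" for k
    proof -
      \<comment> \<open>The other directions contribute factors of at least 1, so one side is no
        longer than the volume of the bottom layer.\<close>
      have "card (f k 0) \<le> (\<Prod>k\<in>A. card (f k 0))"
      proof -
        have "(\<Prod>j\<in>A - {k}. card (f j 0)) \<ge> 1" using pos h by (intro prod_ge_1) auto
        then show ?thesis using prod.remove[OF assms k, of "\<lambda>k. card (f k 0)"] by simp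
      qed
      also have "\<dots> \<le> v" unfolding v[symmetric] using h by (intro member_le_sum) auto
      finally have "f k 0 \<subseteq> {0..int v}"
        using columnsD(1)[OF fk[OF k], of 0] h fk[OF k] unfolding columns_def by auto
      then show ?thesis unfolding D_def
        using columns_subset_0[OF fk[OF k]] columns_ge[OF fk[OF k]] by fastforce
    qed
    ultimately show "h \<in> {..v} \<and> f \<in> A \<rightarrow>\<^sub>E D h" using f by auto
  qed
  ultimately show ?thesis by (rule rev_finite_subset)
qed

section \<open>Splitting off the trivial directions\<close>

lemma prod_unit_column:
  assumes "finite A" "B \<subseteq> A" "a < h" "\<And>k. k \<in> A - B \<Longrightarrow> f k = unit_column h"
  shows "(\<Prod>k\<in>A. card (f k a)) = (\<Prod>k\<in>B. card (f k a))"
  using assms by (intro prod.mono_neutral_right) (auto simp: unit_column_def)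

lemma card_stacks_eq_sum_full:
  assumes "finite A"
  shows "card (stacks e v A) = (\<Sum>B\<in>Pow A. card (full_stacks e v B))"
proof -
  \<comment> \<open>Restriction to the nontrivial directions \<open>B\<close> preserves the volume,
    since a trivial column contributes a factor 1 to each layer. The inverse fills the directions
    outside \<open>B\<close> with \<open>unit_column h\<close>.\<close>
  have "bij_betw (\<lambda>(h, f). ({k\<in>A. f k \<noteq> unit_column h}, h, restrict f {k\<in>A. f k \<noteq> unit_column h}))
      (stacks e v A) (SIGMA B:Pow A. full_stacks e v B)"
  proof (rule bij_betw_byWitness[where
      f' = "\<lambda>(B, h, f). (h, \<lambda>k\<in>A. if k \<in> B then f k else unit_column h)"], goal_cases)
    case 1
    show ?case unfolding stacks_def
      by (auto simp: fun_eq_iff PiE_iff extensional_def)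
  next
    \<comment> \<open>No column of a full stack is trivial, so the extended family has exactly
      \<open>B\<close> as its set of nontrivial directions.\<close>
    case 2
    show ?case unfolding full_stacks_def stacks_def
      by (fastforce simp: fun_eq_iff PiE_iff extensional_def)
  next
    case 3
    show ?case
    proof (clarify)
      fix h f assume hf: "(h, f) \<in> stacks e v A"
      define B where "B = {k\<in>A. f k \<noteq> unit_column h}"
      have "(\<Sum>a<h. \<Prod>k\<in>B. card (restrict f B k a)) = (\<Sum>a<h. \<Prod>k\<in>A. card (f k a))"
        using assms by (intro sum.cong refl)
          (subst prod_unit_column[of A B _ h], auto simp: B_def)
      then show "{k\<in>A. f k \<noteq> unit_column h} \<in> Pow A \<and>
          (h, restrict f {k\<in>A. f k \<noteq> unit_column h})
            \<in> full_stacks e v {k\<in>A. f k \<noteq> unit_column h}"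
        using hf unfolding full_stacks_def stacks_def B_def by auto
    qed
  next
    case 4
    show ?case
    proof (clarify)
      fix B h f assume B: "B \<subseteq> A" and hf: "(h, f) \<in> full_stacks e v B"
      define g where "g = (\<lambda>k\<in>A. if k \<in> B then f k else unit_column h)"
      have "(\<Prod>k\<in>A. card (g k a)) = (\<Prod>k\<in>B. card (f k a))" if "a < h" for a
        using assms B that by (subst prod_unit_column[of A B _ h]) (auto simp: g_def intro!: prod.cong)
      moreover have "g \<in> A \<rightarrow>\<^sub>E columns e h"
        using B hf unit_column_in_columns[of h e]
        unfolding full_stacks_def stacks_def g_def by auto
      ultimately show "(h, \<lambda>k\<in>A. if k \<in> B then f k else unit_column h) \<in> stacks e v A"
        using hf unfolding full_stacks_def stacks_def g_def[symmetric] by auto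
    qed
  qed
  then have "card (stacks e v A) = card (SIGMA B:Pow A. full_stacks e v B)"
    by (rule bij_betw_same_card)
  also have "\<dots> = (\<Sum>B\<in>Pow A. card (full_stacks e v B))"
  proof (rule card_SigmaI)
    show "\<forall>B\<in>Pow A. finite (full_stacks e v B)"
      using assms finite_stacks finite_subset unfolding full_stacks_def
      by (metis (no_types, lifting) PowD mem_Collect_eq subsetI case_prodE)
  qed (use assms in simp)
  finally show ?thesis .
qed

section \<open>Independence of the choice of directions\<close>

text \<open>Renaming the directions only permutes the factors of each layer's volume. Hence the
  number of full stacks over \<open>B\<close> depends on \<open>card B\<close> alone.\<close>

lemma full_stacks_reindex:
  assumes g: "bij_betw g A B" and hf: "(h, f) \<in> full_stacks e v B"
  shows "(h, \<lambda>k\<in>A. f (g k)) \<in> full_stacks e v A"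
proof -
  have "(\<Prod>k\<in>A. card (restrict (\<lambda>k. f (g k)) A k a)) = (\<Prod>k\<in>B. card (f k a))" for a
    using prod.reindex_bij_betw[OF g, of "\<lambda>k. card (f k a)"] by simp
  then show ?thesis
    using hf bij_betwE[OF g] unfolding full_stacks_def stacks_def by auto
qed

lemma card_full_stacks_cong:
  assumes "bij_betw g A B"
  shows "card (full_stacks e v A) = card (full_stacks e v B)"
proof -
  define g' where "g' = inv_into A g"
  have g': "bij_betw g' B A" unfolding g'_def using assms by (rule bij_betw_inv_into)
  have inv: "\<And>x. x \<in> A \<Longrightarrow> g' (g x) = x" "\<And>y. y \<in> B \<Longrightarrow> g (g' y) = y"
    unfolding g'_def using assms
    by (auto simp: bij_betw_inv_into_left bij_betw_inv_into_right)
  have "bij_betw (\<lambda>(h, f). (h, \<lambda>k\<in>B. f (g' k))) (full_stacks e v A) (full_stacks e v B)"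
  proof (rule bij_betw_byWitness[where f' = "\<lambda>(h, f). (h, \<lambda>k\<in>A. f (g k))"], goal_cases)
    case 1
    show ?case using bij_betwE[OF assms] inv unfolding full_stacks_def stacks_def
      by (auto simp: fun_eq_iff PiE_iff extensional_def)
  next
    case 2
    show ?case using bij_betwE[OF g'] inv unfolding full_stacks_def stacks_def
      by (auto simp: fun_eq_iff PiE_iff extensional_def)
  next
    case 3
    show ?case using full_stacks_reindex[OF g'] by auto
  next
    case 4
    show ?case using full_stacks_reindex[OF assms] by auto
  qed
  then show ?thesis by (rule bij_betw_same_card)
qed

lemma card_full_stacks_eq:
  assumes "finite B"
  shows "card (full_stacks e v B) = card (full_stacks e v {..<card B})"
proof -
  obtain g where "bij_betw g {..<card B} B"
    using ex_bij_betw_nat_finite[OF assms] by (auto simp: atLeast0LessThan)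
  then show ?thesis by (metis card_full_stacks_cong)
qed

lemma sum_Pow_card:
  fixes F :: "nat \<Rightarrow> nat"
  assumes "finite A"
  shows "(\<Sum>B\<in>Pow A. F (card B)) = (\<Sum>m\<le>card A. (card A choose m) * F m)"
proof -
  have "(\<Sum>B\<in>Pow A. F (card B)) = (\<Sum>m\<le>card A. \<Sum>B\<in>{B \<in> Pow A. card B = m}. F (card B))"
    using assms by (intro sum.group[symmetric]) (auto intro: card_mono)
  also have "\<dots> = (\<Sum>m\<le>card A. (card A choose m) * F m)"
    using n_subsets[OF assms] by (intro sum.cong refl) (simp add: Pow_def)
  finally show ?thesis .
qed

section \<open>How many nontrivial directions fit into volume v\<close>

lemma full_stacks_empty:
  assumes "v < 2 ^ m"
  shows "full_stacks e v {..<m} = {}"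
proof (rule ccontr)
  assume "full_stacks e v {..<m} \<noteq> {}"
  then obtain h f where h: "h \<ge> 1" and f: "\<And>k. k < m \<Longrightarrow> f k \<in> columns e h"
    and v: "(\<Sum>a<h. \<Prod>k<m. card (f k a)) = v" and ne: "\<And>k. k < m \<Longrightarrow> f k \<noteq> unit_column h"
    unfolding full_stacks_def stacks_def by auto
  \<comment> \<open>The bottom layer alone already has too many cells: each nontrivial direction
    contributes a factor of at least 2.\<close>
  have "(2::nat) ^ m = (\<Prod>k<m. 2)" by simp
  also have "\<dots> \<le> (\<Prod>k<m. card (f k 0))"
    using card_0_ge_2[OF f h ne] by (intro prod_mono) auto
  also have "\<dots> \<le> v" unfolding v[symmetric] using h by (intro member_le_sum) auto
  finally show False using assms by simp
qed

lemma full_stacks_nonempty: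
  assumes "2 ^ m \<le> v"
  shows "full_stacks e v {..<m} \<noteq> {}"
proof -
  \<comment> \<open>All \<open>m\<close> directions use the same column \<open>c\<close>. Its bottom
    {0, 1} yields the cube, and each of the other \<open>v - 2 ^ m\<close> layers is a single cell;
    \<open>Suc\<close> accounts for the bottom layer. All minima are 0, so the stack qualifies for
    either value of \<open>e\<close>.\<close>
  define h where "h = Suc (v - 2 ^ m)"
  define c :: "nat \<Rightarrow> int set" where "c a = (if a = 0 then {0, 1} else unit_column h a)" for a
  have c0: "c 0 = {0..0 + int 2 - 1}" unfolding c_def by auto
  have c1: "c a = {0..0 + int 1 - 1}" if "a \<ge> 1" "a < h" for a
    using that unfolding c_def unit_column_def by auto
  have ex: "\<exists>l\<ge>1. c a = {0..0 + int l - 1}" if "a < h" for a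
    using c0 c1[of a] that by (cases "a = 0") (auto intro: exI[of _ 2] exI[of _ 1])
  have "c a = {}" if "a \<ge> h" for a using that unfolding c_def unit_column_def h_def by auto
  moreover have "c (Suc a) \<subseteq> c a" for a unfolding c_def unit_column_def by auto
  moreover have "Min (c a) = 0" if "a < h" for a
    using ex[OF that] atLeastAtMost_Min_card(1) by blast
  ultimately have col: "c \<in> columns e h" using ex unfolding columns_def h_def by blast
  have ne: "c \<noteq> unit_column h"
  proof
    assume "c = unit_column h"
    then have "c 0 = unit_column h 0" by simp
    then show False unfolding c_def unit_column_def h_def by auto
  qed
  have "(\<Sum>a<h. \<Prod>k<m. card (c a)) = (\<Prod>k<m. card (c 0)) + (\<Sum>a<v - 2 ^ m. \<Prod>k<m. card (c (Suc a)))"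
    unfolding h_def by (rule sum.lessThan_Suc_shift)
  also have "\<dots> = 2 ^ m + (\<Sum>a<v - 2 ^ m. 1)"
    unfolding c_def unit_column_def h_def by (simp add: numeral_2_eq_2)
  also have "\<dots> = v" using assms by simp
  finally have "(h, \<lambda>k\<in>{..<m}. c) \<in> full_stacks e v {..<m}"
    using col ne unfolding full_stacks_def stacks_def h_def by auto
  then show ?thesis by blast
qed

section \<open>Polynomiality and degree\<close>

text \<open>The falling factorial over m!, that is, the binomial coefficient as a polynomial in its
  upper argument.\<close>

definition binomial_poly :: "nat \<Rightarrow> rat poly" where
  "binomial_poly m = smult (1 / fact m) (\<Prod>i<m. [:- of_nat i, 1:])"

lemma poly_binomial_poly: "poly (binomial_poly m) (of_nat d) = of_nat (d choose m)"
  unfolding binomial_poly_def binomial_gbinomial gbinomial_prod_rev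
  by (simp add: poly_prod atLeast0LessThan)

lemma degree_binomial_poly: "degree (binomial_poly m) = m"
  unfolding binomial_poly_def by (simp add: degree_prod_eq_sum_degree)

lemma stacks_polynomial:
  assumes "2 ^ M \<le> v" "v < 2 ^ Suc M"
  shows "\<exists>P :: rat poly. degree P = M \<and> (\<forall>d. of_nat (card (stacks e v {..<d})) = poly P (of_nat d))"
proof -
  define F where "F m = card (full_stacks e v {..<m})" for m
  define P where "P = (\<Sum>m\<le>M. smult (of_nat (F m)) (binomial_poly m))"
  have F0: "F m = 0" if "m > M" for m
  proof -
    have "(2::nat) ^ Suc M \<le> 2 ^ m" using that by (intro power_increasing) auto
    then show ?thesis using assms full_stacks_empty[of v m e] unfolding F_def by simp
  qed
  \<comment> \<open>Nonemptiness alone would not give \<open>F M \<noteq> 0\<close>, since an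
    infinite set has \<open>card\<close> equal to 0.\<close>
  have "finite (full_stacks e v {..<M})"
    by (rule finite_subset[OF _ finite_stacks[of "{..<M}" e v]]) (auto simp: full_stacks_def)
  then have FM: "F M \<noteq> 0" using full_stacks_nonempty[OF assms(1), of e] unfolding F_def by simp
  have "card (stacks e v {..<d}) = (\<Sum>m\<le>M. (d choose m) * F m)" for d
  proof -
    have "card (stacks e v {..<d}) = (\<Sum>B\<in>Pow {..<d}. F (card B))"
      unfolding F_def card_stacks_eq_sum_full[OF finite_lessThan]
      by (intro sum.cong refl card_full_stacks_eq) (auto intro: finite_subset)
    also have "\<dots> = (\<Sum>m\<le>d. (d choose m) * F m)" by (simp add: sum_Pow_card)
    \<comment> \<open>The bound \<open>d\<close> of the sum must be replaced by one independent of
      \<open>d\<close>. Terms with m > d vanish through the binomial coefficient, terms with m > M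
      through \<open>F0\<close>.\<close>
    also have "\<dots> = (\<Sum>m\<le>max d M. (d choose m) * F m)"
      by (rule sum.mono_neutral_left) auto
    also have "\<dots> = (\<Sum>m\<le>M. (d choose m) * F m)"
      by (rule sum.mono_neutral_right) (auto simp: F0)
    finally show ?thesis .
  qed
  then have "of_nat (card (stacks e v {..<d})) = poly P (of_nat d)" for d
    unfolding P_def by (simp add: poly_sum poly_binomial_poly mult.commute)
  moreover have "degree P = M"
  proof (rule antisym)
    show "degree P \<le> M" unfolding P_def
      by (rule degree_sum_le)
        (auto intro: order_trans[OF degree_smult_le] simp: degree_binomial_poly)
    \<comment> \<open>Only the summand m = M reaches degree \<open>M\<close>, so its leading
      coefficient cannot be cancelled.\<close>
    have "coeff P M = (\<Sum>m\<le>M. of_nat (F m) * coeff (binomial_poly m) M)"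
      unfolding P_def by (simp add: coeff_sum)
    also have "\<dots> = (\<Sum>m\<in>{M}. of_nat (F m) * coeff (binomial_poly m) M)"
      by (rule sum.mono_neutral_right) (auto simp: coeff_eq_0 degree_binomial_poly)
    also have "\<dots> = of_nat (F M) * lead_coeff (binomial_poly M)"
      by (simp add: degree_binomial_poly)
    finally have "coeff P M \<noteq> 0" using FM
      by (auto simp: binomial_poly_def)
    then show "M \<le> degree P" by (rule le_degree)
  qed
  ultimately show ?thesis by blast
qed

text \<open>With no directions every layer has volume 1, the empty product, which forces
  \<open>h = v\<close>. The convention for \<open>d = 0\<close> thus agrees with the general count,
  and the same polynomial covers it.\<close>

lemma card_stacks_0:
  assumes "v \<ge> 1"
  shows "card (stacks e v {..<0}) = 1"
proof -
  have "stacks e v {..<0} = {(v, \<lambda>_. undefined)}"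
    using assms unfolding stacks_def by auto
  then show ?thesis by simp
qed

theorem theorem2:
  fixes v :: nat
  assumes "v \<ge> 1"
  shows "(\<exists>P :: rat poly. int (degree P) = \<lfloor>log 2 (real v)\<rfloor> \<and>
            (\<forall>d::nat. of_nat (num_espaliers v d) = poly P (of_nat d))) \<and>
         (\<exists>P :: rat poly. int (degree P) = \<lfloor>log 2 (real v)\<rfloor> \<and>
            (\<forall>d::nat. of_nat (num_pyramids v d) = poly P (of_nat d)))"
proof -
  obtain M where M: "2 ^ M \<le> v" "v < 2 ^ (M + 1)"
    using ex_power_ivl1[of 2 v] assms by auto
  then have deg: "\<lfloor>log 2 (real v)\<rfloor> = int M"
    using floor_log_nat_eq_if[of 2 M v] by simp
  have "num_espaliers v d = card (stacks True v {..<d})" for d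
    using card_pyramids_eq[of d True v] card_stacks_0[OF assms]
    unfolding num_espaliers_def espalier_def by simp
  moreover have "num_pyramids v d = card (stacks False v {..<d})" for d
    using card_pyramids_eq[of d False v] card_stacks_0[OF assms]
    unfolding num_pyramids_def pyramid_def by simp
  ultimately show ?thesis
    using stacks_polynomial[of M v True] stacks_polynomial[of M v False] M deg by auto
qed

end
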